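(* There exists a constant $\kappa_1$ with $\frac12 > \kappa_1 > 0$ such that $$\#\{g \in \mathcal{F}_J : g(x) = 0 \text{ for some } x \in (0,1)\} \sim \kappa_1\, \#\mathcal{F}_J$$ as $J\to\infty$.
   Context: For a positive integer $J$, $\mathcal{F}_J$ denotes the (finite) set of rational functions of the form $$g(x) = \frac{1}{x} + \frac{1}{1-x} + \sum_{\substack{|j| < J \\ j\ne 0,-1}} \frac{\delta_j}{x+j},$$ where $j$ runs over integers and each $\delta_j$ is allowed to take the value $+1$ or $-1$. *)

theory Defs
  imports Complex_Main "HOL-Library.Landau_Symbols"
begin

definition sign_indices :: "nat \<Rightarrow> int set" where
  "sign_indices J = {j. \<bar>j\<bar> < int J \<and> j \<noteq> 0 \<and> j \<noteq> -1}"

(* A rational function is represented by the real function it induces. The convention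
   1 / 0 = 0 only affects the values at the (integer) poles, so it matters neither for zeros
   in the open interval (0,1) nor for which choices of signs give the same function:
   the residues at the poles still determine the signs. *)
definition sign_ratfun :: "nat \<Rightarrow> (int \<Rightarrow> real) \<Rightarrow> real \<Rightarrow> real" where
  "sign_ratfun J \<delta> x = 1 / x + 1 / (1 - x) + (\<Sum>j\<in>sign_indices J. \<delta> j / (x + of_int j))"

definition sign_ratfuns :: "nat \<Rightarrow> (real \<Rightarrow> real) set" where
  "sign_ratfuns J = {sign_ratfun J \<delta> |\<delta>. \<forall>j\<in>sign_indices J. \<delta> j = 1 \<or> \<delta> j = -1}"

lemma finite_sign_indices: "finite (sign_indices J)"
  by (rule finite_subset[of _ "{- int J..int J}"]) (auto simp: sign_indices_def)

lemma finite_sign_ratfuns: "finite (sign_ratfuns J)"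
proof (rule finite_subset)
  let ?f = "\<lambda>A. sign_ratfun J (\<lambda>j. if j \<in> A then 1 else -1)"
  show "finite (?f ` Pow (sign_indices J))"
    by (simp add: finite_sign_indices)
  show "sign_ratfuns J \<subseteq> ?f ` Pow (sign_indices J)"
  proof
    fix g assume "g \<in> sign_ratfuns J"
    then obtain \<delta> where d: "\<forall>j\<in>sign_indices J. \<delta> j = 1 \<or> \<delta> j = -1"
      and g: "g = sign_ratfun J \<delta>"
      by (auto simp: sign_ratfuns_def)
    have "g = ?f {j \<in> sign_indices J. \<delta> j = 1}"
      unfolding g sign_ratfun_def using d by (intro ext arg_cong2[where f = "(+)"] refl sum.cong) auto
    then show "g \<in> ?f ` Pow (sign_indices J)" by blast
  qed
qed

end

theory Submission
  imports Defs
begin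

text \<open>
Write \<open>g = 1/x + 1/(1-x) + h\<close>, where \<open>h\<close> is the random part and the signs are independent and
fair. Since \<open>g\<close> tends to \<open>+\<infinity>\<close> at both ends of \<open>(0,1)\<close>, it has a zero there if and only if it
takes a value \<open>\<le> 0\<close>. The signs are determined by the function, through its residues, so the claim
is that the probability \<open>p\<^sub>J\<close> of such a dip converges to a limit in \<open>(0, 1/2)\<close>.

\<^emph>\<open>Convergence.\<close> Passing from \<open>J\<close> to \<open>J' > J\<close> adds a tail to \<open>h\<close>. Its oscillation on \<open>(0,1)\<close> is
at most a deterministic quantity of order \<open>1/J\<close>, and its value at \<open>1/2\<close> has variance of
order \<open>1/J\<close>, so by Chebyshev the tail is uniformly at most \<open>e\<close> except with small probability.
Hence the dip events for \<open>J\<close> and \<open>J'\<close> can only differ, outside that exceptional event, if the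
minimum of \<open>g\<close> for \<open>J\<close> is within \<open>e\<close> of \<open>0\<close>. That this is unlikely, uniformly in \<open>J\<close>, is
the main point (\<open>sign_prob_critical\<close>): look only at the signs at the positions \<open>1, 4, 16, ..., 4 ^ (K - 1)\<close>
and fix all others. The terms \<open>1/(x + 4 ^ k)\<close> decay so fast that the first sign in which two
choices differ outweighs all later ones, and one of the two functions exceeds the other
by a fixed gap on all of \<open>(0,1)\<close> (\<open>lacunary_gap\<close>). So at most one of the \<open>2 ^ K\<close> choices
has its minimum close to \<open>0\<close>, and the probability is at most \<open>1 / 2 ^ K\<close>. Thus \<open>p\<^sub>J\<close> is a
Cauchy sequence.

\<^emph>\<open>Bounds on the limit.\<close> As \<open>1/x + 1/(1-x) \<ge> 4\<close>, a dip forces \<open>h \<le> -4\<close> somewhere, hence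
\<open>h(1/2) \<le> -8/3\<close> because \<open>h\<close> differs from \<open>h(1/2)\<close> by at most \<open>4/3\<close>. The variance of \<open>h(1/2)\<close>
is at most \<open>8/3\<close>, and the one-sided Chebyshev inequality bounds the probability by \<open>3/11\<close>.
For positivity, prescribe the finitely many signs with \<open>\<bar>j\<bar> < 16\<close> so as to push \<open>g(1/2)\<close> down to
\<open>-1\<close> or less; with probability at least \<open>1/2\<close> the remaining terms do not undo this.
\<close>

section \<open>Uniform random signs\<close>

text \<open>A choice of signs on \<open>S\<close> is encoded by the set of indices that carry \<open>+1\<close>, so that random
signs become uniformly distributed subsets of \<open>S\<close>.\<close>

definition sign :: "int set \<Rightarrow> int \<Rightarrow> real" where
  "sign A j = (if j \<in> A then 1 else -1)"

definition signed_sum :: "int set \<Rightarrow> int set \<Rightarrow> real \<Rightarrow> real" where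
  "signed_sum S A x = (\<Sum>j\<in>S. sign A j / (x + of_int j))"

definition dips :: "int set \<Rightarrow> int set \<Rightarrow> real \<Rightarrow> bool" where
  "dips S A t \<longleftrightarrow> (\<exists>x\<in>{0<..<1}. 1 / x + 1 / (1 - x) + signed_sum S A x \<le> t)"

definition sign_prob :: "int set \<Rightarrow> (int set \<Rightarrow> bool) \<Rightarrow> real" where
  "sign_prob S P = real (card {A \<in> Pow S. P A}) / 2 ^ card S"

lemma abs_sign [simp]: "\<bar>sign A j\<bar> = 1"
  by (simp add: sign_def)

lemma sign_prob_mono:
  assumes "finite S" and "\<And>A. A \<subseteq> S \<Longrightarrow> P A \<Longrightarrow> Q A"
  shows "sign_prob S P \<le> sign_prob S Q"
  unfolding sign_prob_def using assms
  by (intro divide_right_mono of_nat_mono card_mono) auto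

lemma sign_prob_disj:
  assumes "finite S"
  shows "sign_prob S (\<lambda>A. P A \<or> Q A) \<le> sign_prob S P + sign_prob S Q"
proof -
  have "{A \<in> Pow S. P A \<or> Q A} = {A \<in> Pow S. P A} \<union> {A \<in> Pow S. Q A}" by auto
  then have "card {A \<in> Pow S. P A \<or> Q A} \<le> card {A \<in> Pow S. P A} + card {A \<in> Pow S. Q A}"
    by (simp add: card_Un_le)
  then show ?thesis
    unfolding sign_prob_def add_divide_distrib[symmetric]
    by (intro divide_right_mono) (simp_all flip: of_nat_add)
qed

lemma sign_prob_not:
  assumes "finite S"
  shows "sign_prob S (\<lambda>A. \<not> P A) = 1 - sign_prob S P"
proof -
  have "card ({A \<in> Pow S. \<not> P A} \<union> {A \<in> Pow S. P A})
      = card {A \<in> Pow S. \<not> P A} + card {A \<in> Pow S. P A}"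
    using assms by (intro card_Un_disjoint) auto
  also have "{A \<in> Pow S. \<not> P A} \<union> {A \<in> Pow S. P A} = Pow S" by auto
  finally have "card (Pow S) = card {A \<in> Pow S. \<not> P A} + card {A \<in> Pow S. P A}" .
  then have "real (card {A \<in> Pow S. \<not> P A}) = 2 ^ card S - real (card {A \<in> Pow S. P A})"
    using assms by (simp add: card_Pow flip: of_nat_eq_iff[where 'a = real])
  then show ?thesis by (simp add: sign_prob_def diff_divide_distrib)
qed

lemma sign_prob_indep:
  assumes "finite S" "finite T" "S \<inter> T = {}"
  shows "sign_prob (S \<union> T) (\<lambda>A. P (A \<inter> S) \<and> Q (A \<inter> T)) = sign_prob S P * sign_prob T Q"
proof -
  have "bij_betw (\<lambda>A. (A \<inter> S, A \<inter> T)) {A \<in> Pow (S \<union> T). P (A \<inter> S) \<and> Q (A \<inter> T)}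
          ({A \<in> Pow S. P A} \<times> {A \<in> Pow T. Q A})"
  proof (rule bij_betw_byWitness[where f' = "\<lambda>(B, C). B \<union> C"])
    have "(B \<union> C) \<inter> S = B" "(B \<union> C) \<inter> T = C" if "B \<subseteq> S" "C \<subseteq> T" for B C
      using assms(3) that by auto
    then show "\<forall>p\<in>{A \<in> Pow S. P A} \<times> {A \<in> Pow T. Q A}.
        (\<lambda>A. (A \<inter> S, A \<inter> T)) ((\<lambda>(B, C). B \<union> C) p) = p"
      and "(\<lambda>(B, C). B \<union> C) ` ({A \<in> Pow S. P A} \<times> {A \<in> Pow T. Q A})
        \<subseteq> {A \<in> Pow (S \<union> T). P (A \<inter> S) \<and> Q (A \<inter> T)}"
      by auto
  qed auto
  from bij_betw_same_card[OF this] show ?thesis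
    using assms by (simp add: sign_prob_def card_cartesian_product card_Un_disjoint power_add)
qed

text \<open>The case of an event that only looks at the signs on \<open>S\<close>: it has the same probability
whichever larger set of signs is drawn. This puts the dip events for different \<open>J\<close> on one
probability space.\<close>

lemma sign_prob_restrict:
  assumes "finite T" "S \<subseteq> T" "\<And>A. P (A \<inter> S) = P A"
  shows "sign_prob T P = sign_prob S P"
proof -
  have "sign_prob (S \<union> (T - S)) (\<lambda>A. P (A \<inter> S) \<and> True) = sign_prob S P * sign_prob (T - S) (\<lambda>_. True)"
    using assms by (intro sign_prob_indep) (auto intro: finite_subset)
  moreover have "S \<union> (T - S) = T" using assms(2) by auto
  ultimately show ?thesis using assms(1,3) by (simp add: sign_prob_def card_Pow flip: Pow_def)
qed

text \<open>The mixed terms cancel because each sign is \<open>+1\<close> as often as \<open>-1\<close>; in the induction this is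
\<open>(X - c)\<^sup>2 + (X + c)\<^sup>2 = 2 X\<^sup>2 + 2 c\<^sup>2\<close>. The offset \<open>u\<close> absorbs the shift by \<open>c\<close>, and
later allows a one-sided Chebyshev inequality.\<close>

lemma sum_Pow_signed_sum_square:
  fixes c :: "int \<Rightarrow> real"
  assumes "finite S"
  shows "(\<Sum>A\<in>Pow S. (u + (\<Sum>j\<in>S. sign A j * c j))\<^sup>2) = 2 ^ card S * (u\<^sup>2 + (\<Sum>j\<in>S. (c j)\<^sup>2))"
  using assms
proof (induction S arbitrary: u)
  case empty
  then show ?case by simp
next
  case (insert a S)
  have inside: "(\<Sum>j\<in>S. sign (insert a A) j * c j) = (\<Sum>j\<in>S. sign A j * c j)" for A
    using insert.hyps by (intro sum.cong) (auto simp: sign_def)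
  have "inj_on (insert a) (Pow S)" using insert.hyps by (auto simp: inj_on_def)
  then have "(\<Sum>A\<in>Pow (insert a S). (u + (\<Sum>j\<in>insert a S. sign A j * c j))\<^sup>2)
    = (\<Sum>A\<in>Pow S. (u + (\<Sum>j\<in>insert a S. sign A j * c j))\<^sup>2)
      + (\<Sum>A\<in>Pow S. (u + (\<Sum>j\<in>insert a S. sign (insert a A) j * c j))\<^sup>2)"
    using insert.hyps unfolding Pow_insert
    by (subst sum.union_disjoint) (auto simp: sum.reindex)
  also have "(\<Sum>A\<in>Pow S. (u + (\<Sum>j\<in>insert a S. sign (insert a A) j * c j))\<^sup>2)
      = (\<Sum>A\<in>Pow S. ((u + c a) + (\<Sum>j\<in>S. sign A j * c j))\<^sup>2)"
    using insert.hyps inside by (intro sum.cong) (auto simp: sign_def add.assoc)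
  also have "(\<Sum>A\<in>Pow S. (u + (\<Sum>j\<in>insert a S. sign A j * c j))\<^sup>2)
      = (\<Sum>A\<in>Pow S. ((u - c a) + (\<Sum>j\<in>S. sign A j * c j))\<^sup>2)"
    using insert.hyps by (intro sum.cong) (auto simp: sign_def algebra_simps)
  finally show ?case
    using insert.hyps unfolding insert.IH by (simp add: power2_eq_square algebra_simps)
qed

lemma sign_prob_Chebyshev:
  fixes c :: "int \<Rightarrow> real"
  assumes "finite S" "t > 0"
  shows "sign_prob S (\<lambda>A. t \<le> \<bar>u + (\<Sum>j\<in>S. sign A j * c j)\<bar>) \<le> (u\<^sup>2 + (\<Sum>j\<in>S. (c j)\<^sup>2)) / t\<^sup>2"
proof -
  let ?X = "\<lambda>A. u + (\<Sum>j\<in>S. sign A j * c j)"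
  let ?E = "{A \<in> Pow S. t \<le> \<bar>?X A\<bar>}"
  have "real (card ?E) * t\<^sup>2 = (\<Sum>A\<in>?E. t\<^sup>2)" by simp
  also have "\<dots> \<le> (\<Sum>A\<in>?E. (?X A)\<^sup>2)"
    using assms by (intro sum_mono) (auto simp: abs_le_square_iff[symmetric])
  also have "\<dots> \<le> (\<Sum>A\<in>Pow S. (?X A)\<^sup>2)"
    using assms by (intro sum_mono2) auto
  also have "\<dots> = 2 ^ card S * (u\<^sup>2 + (\<Sum>j\<in>S. (c j)\<^sup>2))"
    by (rule sum_Pow_signed_sum_square[OF assms(1)])
  finally show ?thesis
    using assms(2) by (simp add: sign_prob_def field_simps)
qed

section \<open>Size and oscillation of the random part\<close>

text \<open>The reflection \<open>x \<mapsto> 1 - x\<close> exchanges the indices \<open>j\<close> and \<open>-1 - j\<close>. The depth is the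
distance from the pole \<open>-j\<close> to the interval \<open>(0,1)\<close>, and does not distinguish the two.\<close>

definition depth :: "int \<Rightarrow> nat" where
  "depth j = nat (if j \<ge> 0 then j else - 1 - j)"

text \<open>For depth at least \<open>1\<close>, the weight of the depth of \<open>j\<close> bounds two things: the variance of \<open>\<plusminus>1/(1/2 + j)\<close>, and twice
the distance of \<open>1/(x + j)\<close> from \<open>1/(1/2 + j)\<close> for \<open>x\<close> in \<open>(0,1)\<close>.\<close>

definition weight :: "nat \<Rightarrow> real" where
  "weight k = 1 / (real k * (real k + 1/2))"

lemma depth_le_abs: "0 < x \<Longrightarrow> x < 1 \<Longrightarrow> real (depth j) \<le> \<bar>x + of_int j\<bar>"
  by (cases "j \<ge> 0") (auto simp: depth_def)

lemma abs_half_plus: "\<bar>1/2 + of_int j :: real\<bar> = real (depth j) + 1/2"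
  by (cases "j \<ge> 0") (auto simp: depth_def)

text \<open>The weight is dominated by the telescoping difference \<open>1/(k - 1/4) - 1/(k + 3/4)\<close>. The shift
\<open>1/4\<close> makes \<open>(k - 1/4) (k + 3/4)\<close> agree with \<open>k (k + 1/2)\<close> up to a constant, and so keeps the
total weight small enough for the upper bound below \<open>1/2\<close>.\<close>

lemma sum_weight_nat_le:
  assumes "finite T" "K \<ge> 1" "\<And>k. k \<in> T \<Longrightarrow> K \<le> k"
  shows "sum weight T \<le> 1 / (real K - 1/4)"
proof -
  define M where "M = Max (insert K T)"
  have "T \<subseteq> {K..M}" and "K \<le> M" using assms by (auto simp: M_def)
  have "sum weight T \<le> sum weight {K..M}"
    using \<open>T \<subseteq> {K..M}\<close> by (intro sum_mono2) (auto simp: weight_def)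
  also have "\<dots> \<le> (\<Sum>k=K..M. 1 / (real k - 1/4) - 1 / (real (Suc k) - 1/4))"
  proof (intro sum_mono)
    fix k assume "k \<in> {K..M}"
    then have k: "real k \<ge> 1" using assms(2) by simp
    have "1 / (real k * (real k + 1/2)) \<le> 1 / ((real k - 1/4) * (real k + 3/4))"
      using k by (intro divide_left_mono mult_pos_pos) (simp_all add: algebra_simps)
    also have "\<dots> = 1 / (real k - 1/4) - 1 / (real (Suc k) - 1/4)"
      using k by (simp add: field_simps)
    finally show "weight k \<le> 1 / (real k - 1/4) - 1 / (real (Suc k) - 1/4)"
      by (simp add: weight_def)
  qed
  also have "\<dots> = 1 / (real K - 1/4) - 1 / (real (Suc M) - 1/4)"
    using sum_Suc_diff[of K M "\<lambda>k. - 1 / (real k - 1/4)"] \<open>K \<le> M\<close> by simp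
  also have "\<dots> \<le> 1 / (real K - 1/4)" by simp
  finally show ?thesis .
qed

lemma sum_weight_depth_le:
  assumes "finite S" "K \<ge> 1" "\<And>j. j \<in> S \<Longrightarrow> K \<le> depth j"
  shows "(\<Sum>j\<in>S. weight (depth j)) \<le> 2 / (real K - 1/4)"
proof -
  have part: "(\<Sum>j\<in>R. weight (depth j)) \<le> 1 / (real K - 1/4)"
    if "R \<subseteq> S" "inj_on depth R" for R
  proof -
    have "(\<Sum>j\<in>R. weight (depth j)) = sum weight (depth ` R)"
      using that by (simp add: sum.reindex)
    also have "\<dots> \<le> 1 / (real K - 1/4)"
      using assms that by (intro sum_weight_nat_le) (auto intro: finite_subset)
    finally show ?thesis .
  qed
  have "(\<Sum>j\<in>S. weight (depth j))
      = (\<Sum>j\<in>S \<inter> {0..}. weight (depth j)) + (\<Sum>j\<in>S - {0..}. weight (depth j))"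
    using assms(1) by (rule sum.Int_Diff)
  also have "\<dots> \<le> 1 / (real K - 1/4) + 1 / (real K - 1/4)"
    by (intro add_mono part) (auto simp: inj_on_def depth_def)
  finally show ?thesis by simp
qed

lemma variance_at_half_le:
  assumes "depth j \<ge> 1"
  shows "(1 / (1/2 + of_int j :: real))\<^sup>2 \<le> weight (depth j)"
proof -
  have "(1 / (1/2 + of_int j :: real))\<^sup>2 = 1 / \<bar>1/2 + of_int j\<bar>\<^sup>2"
    by (simp add: power_divide)
  also have "\<dots> \<le> weight (depth j)"
    unfolding abs_half_plus weight_def power2_eq_square using assms
    by (intro divide_left_mono mult_right_mono) auto
  finally show ?thesis .
qed

lemma signed_sum_variation:
  assumes "finite S" "\<And>j. j \<in> S \<Longrightarrow> depth j \<ge> 1" "0 < x" "x < 1"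
  shows "\<bar>signed_sum S A x - signed_sum S A (1/2)\<bar> \<le> (\<Sum>j\<in>S. weight (depth j)) / 2"
proof -
  have term_le: "\<bar>sign A j / (x + of_int j) - sign A j / (1/2 + of_int j)\<bar> \<le> weight (depth j) / 2"
    if "j \<in> S" for j
  proof -
    have d: "real (depth j) \<ge> 1" using assms(2)[OF that] by simp
    have x: "\<bar>x + of_int j\<bar> \<ge> real (depth j)" using assms depth_le_abs by blast
    have "x + of_int j \<noteq> 0" using x d by auto
    moreover have "1/2 + of_int j \<noteq> (0::real)" using abs_half_plus[of j] d by auto
    ultimately have "sign A j / (x + of_int j) - sign A j / (1/2 + of_int j)
        = sign A j * (1/2 - x) / ((x + of_int j) * (1/2 + of_int j))"
      by (subst diff_frac_eq) (simp_all add: algebra_simps)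
    then have "\<bar>sign A j / (x + of_int j) - sign A j / (1/2 + of_int j)\<bar>
        = \<bar>1/2 - x\<bar> / (\<bar>x + of_int j\<bar> * (real (depth j) + 1/2))"
      by (simp only: abs_mult abs_divide abs_sign abs_half_plus)
    also have "\<dots> \<le> (1/2) / (real (depth j) * (real (depth j) + 1/2))"
      using assms x d by (intro frac_le mult_right_mono) (auto simp: abs_if)
    finally show ?thesis by (simp add: weight_def mult.commute)
  qed
  have "\<bar>signed_sum S A x - signed_sum S A (1/2)\<bar>
      \<le> (\<Sum>j\<in>S. \<bar>sign A j / (x + of_int j) - sign A j / (1/2 + of_int j)\<bar>)"
    unfolding signed_sum_def sum_subtractf[symmetric] by (rule sum_abs)
  also have "\<dots> \<le> (\<Sum>j\<in>S. weight (depth j) / 2)" by (intro sum_mono term_le)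
  finally show ?thesis by (simp add: sum_divide_distrib)
qed

lemma sign_prob_Chebyshev_at_half:
  assumes "finite S" "K \<ge> 1" "\<And>j. j \<in> S \<Longrightarrow> K \<le> depth j" "t > 0"
  shows "sign_prob S (\<lambda>A. t \<le> \<bar>u + signed_sum S A (1/2)\<bar>) \<le> (u\<^sup>2 + 2 / (real K - 1/4)) / t\<^sup>2"
proof -
  have "sign_prob S (\<lambda>A. t \<le> \<bar>u + signed_sum S A (1/2)\<bar>)
      \<le> (u\<^sup>2 + (\<Sum>j\<in>S. (1 / (1/2 + of_int j))\<^sup>2)) / t\<^sup>2"
    using sign_prob_Chebyshev[OF assms(1,4), of u "\<lambda>j. 1 / (1/2 + of_int j)"]
    by (simp add: signed_sum_def)
  also have "(\<Sum>j\<in>S. (1 / (1/2 + of_int j :: real))\<^sup>2) \<le> (\<Sum>j\<in>S. weight (depth j))"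
    using assms by (intro sum_mono variance_at_half_le) (meson le_trans)
  also have "\<dots> \<le> 2 / (real K - 1/4)"
    using assms by (intro sum_weight_depth_le) auto
  finally show ?thesis by (simp add: divide_right_mono)
qed

lemma four_le_inverse_sum:
  fixes x :: real
  assumes x: "0 < x" "x < 1"
  shows "4 \<le> 1 / x + 1 / (1 - x)"
proof -
  have "4 * (x * (1 - x)) \<le> 1"
    using zero_le_square[of "2 * x - 1"] by (simp add: algebra_simps)
  then have "4 \<le> 1 / (x * (1 - x))" using x by (simp add: field_simps)
  also have "\<dots> = 1 / x + 1 / (1 - x)" using x by (simp add: field_simps)
  finally show ?thesis .
qed

lemma finite_sign_indices_diff: "finite (sign_indices J' - sign_indices J)"
  by (simp add: finite_sign_indices)

lemma depth_sign_indices: "j \<in> sign_indices J \<Longrightarrow> 1 \<le> depth j"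
  by (auto simp: sign_indices_def depth_def)

lemma depth_sign_indices_diff: "j \<in> sign_indices J' - sign_indices J \<Longrightarrow> J - 1 \<le> depth j"
  by (auto simp: sign_indices_def depth_def)

lemma sign_indices_mono: "J \<le> J' \<Longrightarrow> sign_indices J \<subseteq> sign_indices J'"
  by (auto simp: sign_indices_def)

lemma signed_sum_Int: "signed_sum S (A \<inter> S) x = signed_sum S A x"
  unfolding signed_sum_def by (intro sum.cong) (auto simp: sign_def)

lemma dips_Int: "dips S (A \<inter> S) t = dips S A t"
  by (simp add: dips_def signed_sum_Int)

lemma signed_sum_diff:
  assumes "finite S'" "S \<subseteq> S'"
  shows "signed_sum S' A x = signed_sum S A x + signed_sum (S' - S) A x"
  unfolding signed_sum_def using sum.subset_diff[OF assms(2,1)] by (simp add: add.commute)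

section \<open>Bounds for the probability of a dip\<close>

text \<open>One-sided Chebyshev (Cantelli): \<open>h(1/2) \<le> -8/3\<close> is detected through the shifted variable
\<open>h(1/2) - 1\<close>. With variance \<open>8/3\<close>, the shift \<open>1\<close> is the optimal one.\<close>

lemma dips_upper_bound: "sign_prob (sign_indices J) (\<lambda>A. dips (sign_indices J) A 0) \<le> 3 / 11"
proof -
  let ?S = "sign_indices J"
  have half: "11/3 \<le> \<bar>-1 + signed_sum ?S A (1/2)\<bar>" if "dips ?S A 0" for A
  proof -
    obtain x where x: "0 < x" "x < 1" and le: "1 / x + 1 / (1 - x) + signed_sum ?S A x \<le> 0"
      using \<open>dips ?S A 0\<close> by (auto simp: dips_def)
    have "(\<Sum>j\<in>?S. weight (depth j)) \<le> 2 / (real 1 - 1/4)"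
      using finite_sign_indices depth_sign_indices by (intro sum_weight_depth_le) auto
    then have "(\<Sum>j\<in>?S. weight (depth j)) \<le> 8/3" by simp
    moreover have "\<bar>signed_sum ?S A x - signed_sum ?S A (1/2)\<bar> \<le> (\<Sum>j\<in>?S. weight (depth j)) / 2"
      using x finite_sign_indices depth_sign_indices by (intro signed_sum_variation) auto
    ultimately have "signed_sum ?S A (1/2) \<le> - 8/3" using four_le_inverse_sum[OF x] le by linarith
    then show ?thesis by simp
  qed
  have "sign_prob ?S (\<lambda>A. dips ?S A 0) \<le> sign_prob ?S (\<lambda>A. 11/3 \<le> \<bar>-1 + signed_sum ?S A (1/2)\<bar>)"
    using half finite_sign_indices by (intro sign_prob_mono) auto
  also have "\<dots> \<le> ((-1)\<^sup>2 + 2 / (real 1 - 1/4)) / (11/3)\<^sup>2"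
    using finite_sign_indices depth_sign_indices by (intro sign_prob_Chebyshev_at_half) auto
  also have "\<dots> = 3 / 11" by (simp add: power2_eq_square)
  finally show ?thesis .
qed

text \<open>The chosen signs make every term \<open>\<plusminus>1/(1/2 + j)\<close> negative. The bound beats
\<open>1/x + 1/(1-x) = 4\<close> at \<open>1/2\<close> with a margin of \<open>1\<close>, and \<open>16\<close> is large enough for that.\<close>

lemma favourable_signs: "signed_sum (sign_indices 16) {..<0} (1/2) \<le> -5"
proof -
  have S: "sign_indices 16 = set ([-15..-2] @ [1..15])"
    by (rule set_eqI) (simp only: set_append set_upto Un_iff atLeastAtMost_iff sign_indices_def
      mem_Collect_eq, presburger)
  have "signed_sum (sign_indices 16) {..<0} (1/2)
      = sum_list (map (\<lambda>j. sign {..<0} j / (1/2 + of_int j)) ([-15..-2] @ [1..15]))"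
    unfolding signed_sum_def S by (rule sum.distinct_set_conv_list) auto
  also have "\<dots> \<le> -5"
    by (simp add: sign_def upto.simps)
  finally show ?thesis .
qed

lemma dips_lower_bound:
  assumes "J \<ge> 16"
  shows "1 / 2 ^ card (sign_indices 16) / 2 \<le> sign_prob (sign_indices J) (\<lambda>A. dips (sign_indices J) A 0)"
proof -
  let ?S = "sign_indices 16" and ?T = "sign_indices J - sign_indices 16"
  define A0 where "A0 = {..<0} \<inter> ?S"
  let ?Q = "\<lambda>B. \<not> 1 \<le> \<bar>0 + signed_sum ?T B (1/2)\<bar>"
  have ST: "?S \<union> ?T = sign_indices J" using sign_indices_mono[OF assms] by auto
  have "{A \<in> Pow ?S. A = A0} = {A0}" by (auto simp: A0_def)
  then have S: "sign_prob ?S (\<lambda>A. A = A0) = 1 / 2 ^ card ?S" by (simp add: sign_prob_def)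
  have "sign_prob ?T (\<lambda>B. 1 \<le> \<bar>0 + signed_sum ?T B (1/2)\<bar>) \<le> (0\<^sup>2 + 2 / (real 15 - 1/4)) / 1\<^sup>2"
    using depth_sign_indices_diff[of _ J 16] finite_sign_indices_diff
    by (intro sign_prob_Chebyshev_at_half) auto
  also have "\<dots> \<le> 1/2" by simp
  finally have T: "1/2 \<le> sign_prob ?T ?Q"
    by (simp add: sign_prob_not finite_sign_indices)
  have "1 / 2 ^ card ?S / 2 = 1 / 2 ^ card ?S * (1 / 2 :: real)" by simp
  also have "\<dots> \<le> sign_prob ?S (\<lambda>A. A = A0) * sign_prob ?T ?Q"
    unfolding S using T by (intro mult_left_mono) auto
  also have "\<dots> = sign_prob (?S \<union> ?T) (\<lambda>A. A \<inter> ?S = A0 \<and> ?Q (A \<inter> ?T))"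
    using finite_sign_indices by (intro sign_prob_indep[symmetric]) auto
  also have "\<dots> \<le> sign_prob (?S \<union> ?T) (\<lambda>A. dips (sign_indices J) A 0)"
  proof (intro sign_prob_mono)
    fix A assume A: "A \<inter> ?S = A0 \<and> ?Q (A \<inter> ?T)"
    have "signed_sum ?S A (1/2) = signed_sum ?S {..<0} (1/2)"
      using A signed_sum_Int[of ?S A] signed_sum_Int[of ?S "{..<0}"] by (simp add: A0_def)
    then have "signed_sum ?S A (1/2) \<le> -5" using favourable_signs by simp
    moreover have "signed_sum ?T A (1/2) \<le> 1" using A by (simp add: signed_sum_Int abs_if split: if_splits)
    ultimately have "signed_sum (sign_indices J) A (1/2) \<le> -4"
      using signed_sum_diff[OF finite_sign_indices sign_indices_mono[OF assms], of A "1/2"] by simp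
    then show "dips (sign_indices J) A 0"
      unfolding dips_def by (intro bexI[of _ "1/2"]) auto
  qed (simp add: finite_sign_indices)
  finally show ?thesis by (simp only: ST)
qed

section \<open>The minimum is rarely close to zero\<close>

definition lacunary :: "nat \<Rightarrow> int set" where
  "lacunary K = (\<lambda>k. 4 ^ k) ` {..<K}"

text \<open>Switching the sign at \<open>j0 = 4 ^ k\<close> from \<open>-1\<close> to \<open>+1\<close> raises the function by at least
\<open>2 / (4 ^ k + 1) \<ge> 1 / 4 ^ k\<close>, whereas all changes at \<open>4 ^ l\<close> with \<open>l > k\<close> together lower it by
at most \<open>(2/3) / 4 ^ k\<close>. What remains is a gap that does not depend on \<open>x\<close> or \<open>S\<close>.\<close>

lemma lacunary_gap:
  assumes S: "finite S" and j0: "j0 \<in> S" "j0 \<in> A" "j0 \<notin> B" "j0 \<in> lacunary K"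
    and agree: "A - lacunary K = B - lacunary K"
    and first: "\<And>j. j \<in> lacunary K \<Longrightarrow> j < j0 \<Longrightarrow> j \<in> A \<longleftrightarrow> j \<in> B"
    and x: "0 < x" "x < 1"
  shows "signed_sum S B x + 1 / (3 * 4 ^ K) \<le> signed_sum S A x"
proof -
  obtain k where k: "j0 = 4 ^ k" "k < K" using j0 by (auto simp: lacunary_def)
  define D where "D = (\<lambda>l. 4 ^ l :: int) ` {Suc k..<K}"
  let ?d = "\<lambda>j. (sign A j - sign B j) / (x + of_int j)"
  have later: "j \<in> D" if "j \<noteq> j0" "\<not> (j \<in> A \<longleftrightarrow> j \<in> B)" for j
  proof -
    have "j \<in> lacunary K" using agree that by blast
    then obtain l where l: "j = 4 ^ l" "l < K" by (auto simp: lacunary_def)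
    have "\<not> j < j0" using first \<open>j \<in> lacunary K\<close> that by blast
    then have "k < l" using that(1) unfolding l k by (simp add: order_less_le)
    then show ?thesis using l by (auto simp: D_def)
  qed
  have term_ge: "(if j \<in> D then - 2 / of_int j else 0) \<le> ?d j" if "j \<in> S - {j0}" for j
  proof (cases "j \<in> D")
    case True
    then have "(1::real) \<le> of_int j" by (auto simp: D_def)
    then have "\<bar>?d j\<bar> \<le> 2 / of_int j"
      unfolding abs_divide using x by (intro frac_le) (auto simp: sign_def)
    then have "- (2 / of_int j) \<le> ?d j" by linarith
    then show ?thesis using True by simp
  next
    case False
    then have "sign A j = sign B j" using later that by (auto simp: sign_def)
    then show ?thesis using False by simp
  qed
  have "(\<Sum>j\<in>D. 2 / real_of_int j) = (\<Sum>l\<in>{Suc k..<K}. 2 / 4 ^ l)"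
    unfolding D_def by (subst sum.reindex) (auto simp: inj_on_def)
  also have "\<dots> = (\<Sum>l\<in>{Suc k..<K}. (- 8 / 3 / 4 ^ Suc l) - (- 8 / 3 / 4 ^ l))"
    by (intro sum.cong) (simp_all add: field_simps)
  also have "\<dots> = 2 / 3 / 4 ^ k - 8 / 3 / 4 ^ K"
    using k(2) by (subst sum_Suc_diff') simp_all
  finally have tail: "(\<Sum>j\<in>D. 2 / real_of_int j) \<le> 2 / 3 / 4 ^ k"
    by (simp add: le_diff_eq[symmetric])
  have "- (\<Sum>j\<in>S - {j0}. ?d j) \<le> - (\<Sum>j\<in>S - {j0}. if j \<in> D then - 2 / of_int j else 0)"
    using term_ge by (intro le_imp_neg_le sum_mono) auto
  also have "\<dots> = (\<Sum>j\<in>(S - {j0}) \<inter> D. 2 / real_of_int j)"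
    using S by (simp add: sum.inter_restrict if_distrib flip: sum_negf cong: if_cong)
  also have "\<dots> \<le> (\<Sum>j\<in>D. 2 / real_of_int j)"
    by (intro sum_mono2) (auto simp: D_def)
  also note tail
  finally have rest: "- (2 / 3 / 4 ^ k) \<le> (\<Sum>j\<in>S - {j0}. ?d j)" by simp
  have "1 / (3 * 4 ^ K) \<le> 1 / (3 * 4 ^ k :: real)"
    using k(2) by (intro divide_left_mono mult_left_mono power_increasing) auto
  also have "\<dots> = 2 / (2 * 4 ^ k) - 2 / 3 / 4 ^ k"
    by (simp add: field_simps)
  also have "\<dots> \<le> 2 / (x + 4 ^ k) - 2 / 3 / 4 ^ k"
  proof (intro diff_right_mono divide_left_mono)
    have "(1::real) \<le> 4 ^ k" by simp
    then show "x + 4 ^ k \<le> 2 * 4 ^ k" using x by linarith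
  qed (use x in \<open>auto intro!: mult_pos_pos add_pos_pos\<close>)
  also have "\<dots> \<le> 2 / (x + 4 ^ k) + (\<Sum>j\<in>S - {j0}. ?d j)"
    using rest by simp
  also have "\<dots> = (\<Sum>j\<in>S. ?d j)"
    using S j0 by (simp add: sum.remove[of S j0] k sign_def)
  also have "\<dots> = signed_sum S A x - signed_sum S B x"
    by (simp add: signed_sum_def diff_divide_distrib sum_subtractf)
  finally show ?thesis by simp
qed

text \<open>The event says that the infimum of the function is within \<open>e\<close> of \<open>0\<close>. By the gap lemma
a sign pattern in it is determined by its restriction to the complement of the lacunary set.\<close>

lemma sign_prob_critical:
  assumes "finite S" "lacunary K \<subseteq> S" "6 * 4 ^ K * e \<le> 1"
  shows "sign_prob S (\<lambda>A. dips S A e \<and> \<not> dips S A (- e)) \<le> 1 / 2 ^ K"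
proof -
  let ?L = "lacunary K" and ?W = "\<lambda>A. dips S A e \<and> \<not> dips S A (- e)"
  have e: "2 * e \<le> 1 / (3 * 4 ^ K)" using assms(3) by (simp add: field_simps)
  have False
    if "?W A" "?W B" "A - ?L = B - ?L" "j \<in> ?L" "j \<in> A" "j \<notin> B"
      "\<And>i. i \<in> ?L \<Longrightarrow> i < j \<Longrightarrow> i \<in> A \<longleftrightarrow> i \<in> B" for A B j
  proof -
    have low: "dips S A e" using that(1) by blast
    obtain x where x: "0 < x" "x < 1" "1 / x + 1 / (1 - x) + signed_sum S A x \<le> e"
      using low unfolding dips_def by auto
    have "signed_sum S B x + 1 / (3 * 4 ^ K) \<le> signed_sum S A x"
      using lacunary_gap[of S j A B K x] assms(1,2) that(3-7) x(1,2) by blast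
    then have "dips S B (- e)" using x e by (auto simp: dips_def intro!: bexI[of _ x])
    then show False using that(2) by blast
  qed note gap = this
  have "inj_on (\<lambda>A. A - ?L) {A \<in> Pow S. ?W A}"
  proof (rule inj_onI, rule ccontr)
    fix A B assume A: "A \<in> {A \<in> Pow S. ?W A}" and B: "B \<in> {A \<in> Pow S. ?W A}"
      and eq: "A - ?L = B - ?L" and "A \<noteq> B"
    define D where "D = {j \<in> ?L. \<not> (j \<in> A \<longleftrightarrow> j \<in> B)}"
    have "finite D" "D \<noteq> {}" using eq \<open>A \<noteq> B\<close> by (auto simp: D_def lacunary_def)
    \<comment> \<open>The least position carries the largest term, so it decides which function is larger.\<close>
    define j where "j = Min D"
    have "j \<in> D" using \<open>finite D\<close> \<open>D \<noteq> {}\<close> by (simp add: j_def)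
    moreover have "i \<in> A \<longleftrightarrow> i \<in> B" if "i \<in> ?L" "i < j" for i
      using that \<open>finite D\<close> \<open>D \<noteq> {}\<close> by (auto simp: j_def D_def)
    ultimately show False
      using gap[of A B j] gap[of B A j] A B eq by (auto simp: D_def)
  qed
  then have "card {A \<in> Pow S. ?W A} \<le> card (Pow (S - ?L))"
    using assms(1) by (intro card_inj_on_le[where f = "\<lambda>A. A - ?L"]) auto
  also have "\<dots> = 2 ^ card (S - ?L)" using assms(1) by (simp add: card_Pow)
  finally have "real (card {A \<in> Pow S. ?W A}) \<le> real (2 ^ card (S - ?L))"
    by (rule of_nat_mono)
  then have "sign_prob S ?W \<le> 2 ^ card (S - ?L) / 2 ^ card S"
    unfolding sign_prob_def by (intro divide_right_mono) auto
  moreover have "card S = card (S - ?L) + K"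
  proof -
    have "card ?L = K" unfolding lacunary_def by (subst card_image) (auto simp: inj_on_def)
    then show ?thesis
      using assms(1,2) card_mono[OF assms(1,2)] by (simp add: card_Diff_subset finite_subset)
  qed
  ultimately show ?thesis by (simp add: power_add)
qed

section \<open>Convergence of the probability of a dip\<close>

definition dip_prob :: "nat \<Rightarrow> real" where
  "dip_prob J = sign_prob (sign_indices J) (\<lambda>A. dips (sign_indices J) A 0)"

text \<open>The first summand is the probability that the minimum for \<open>J\<close> is within \<open>e\<close> of \<open>0\<close>. The second
one is the probability that the tail from \<open>J\<close> to \<open>J'\<close> exceeds \<open>e / 2\<close> at the midpoint; the other
half of \<open>e\<close> is spent on the oscillation of the tail.\<close>

lemma dip_prob_diff_le:
  assumes "J \<le> J'" "2 \<le> J" "4 ^ K < J" "e > 0" "6 * 4 ^ K * e \<le> 1"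
    and far: "2 / (real (J - 1) - 1/4) \<le> e"
  shows "\<bar>dip_prob J' - dip_prob J\<bar> \<le> 1 / 2 ^ K + 2 / (real (J - 1) - 1/4) / (e / 2)\<^sup>2"
proof -
  let ?S = "sign_indices J" and ?S' = "sign_indices J'" and ?T = "sign_indices J' - sign_indices J"
  let ?P = "\<lambda>A. dips ?S A 0" and ?P' = "\<lambda>A. dips ?S' A 0"
  let ?W = "\<lambda>A. dips ?S A e \<and> \<not> dips ?S A (- e)"
  let ?F = "\<lambda>A. e / 2 \<le> \<bar>0 + signed_sum ?T A (1/2)\<bar>"
  have sub: "?S \<subseteq> ?S'" by (rule sign_indices_mono[OF assms(1)])
  have depth: "J - 1 \<le> depth j" if "j \<in> ?T" for j using depth_sign_indices_diff that by blast
  have "lacunary K \<subseteq> ?S"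
  proof
    fix j assume "j \<in> lacunary K"
    then obtain k where k: "j = 4 ^ k" "k < K" by (auto simp: lacunary_def)
    have "(4::int) ^ k \<le> 4 ^ K" using k by (intro power_increasing) auto
    also have "\<dots> < int J" using assms(3) by (metis of_nat_less_iff of_nat_numeral of_nat_power)
    finally have "\<bar>j\<bar> < int J" using k by simp
    moreover have "0 < j" using k by simp
    ultimately show "j \<in> ?S" by (simp add: sign_indices_def)
  qed
  then have "sign_prob ?S ?W \<le> 1 / 2 ^ K"
    by (rule sign_prob_critical[OF finite_sign_indices _ assms(5)])
  moreover have "sign_prob ?S' ?W = sign_prob ?S ?W"
    by (rule sign_prob_restrict[OF finite_sign_indices sub]) (simp only: dips_Int)
  ultimately have W: "sign_prob ?S' ?W \<le> 1 / 2 ^ K" by simp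
  have "sign_prob ?T ?F \<le> (0\<^sup>2 + 2 / (real (J - 1) - 1/4)) / (e / 2)\<^sup>2"
    using assms depth finite_sign_indices_diff by (intro sign_prob_Chebyshev_at_half) auto
  then have F: "sign_prob ?S' ?F \<le> 2 / (real (J - 1) - 1/4) / (e / 2)\<^sup>2"
    using sign_prob_restrict[OF finite_sign_indices, of ?T J' ?F] by (simp add: signed_sum_Int)
  have close: "\<bar>signed_sum ?S' A x - signed_sum ?S A x\<bar> \<le> e" if "\<not> ?F A" "0 < x" "x < 1" for A x
  proof -
    have "(\<Sum>j\<in>?T. weight (depth j)) \<le> 2 / (real (J - 1) - 1/4)"
      using assms(2) depth finite_sign_indices_diff by (intro sum_weight_depth_le) auto
    moreover have "\<bar>signed_sum ?T A x - signed_sum ?T A (1/2)\<bar> \<le> (\<Sum>j\<in>?T. weight (depth j)) / 2"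
      using that depth_sign_indices finite_sign_indices_diff by (intro signed_sum_variation) auto
    ultimately have "\<bar>signed_sum ?T A x\<bar> \<le> e" using that(1) far by linarith
    then show ?thesis using signed_sum_diff[OF finite_sign_indices sub] by simp
  qed
  have up: "?P A \<or> (?W A \<or> ?F A)" if "?P' A" for A
  proof (cases "?F A")
    case False
    then have "dips ?S A e" using that close unfolding dips_def by (smt (verit) greaterThanLessThan_iff)
    moreover have "?P A" if "dips ?S A (- e)" using that assms(4) by (force simp: dips_def)
    ultimately show ?thesis by blast
  qed auto
  have down: "?P' A \<or> (?W A \<or> ?F A)" if "?P A" for A
  proof (cases "?F A")
    case False
    have "dips ?S A e" using that assms(4) by (force simp: dips_def)
    moreover have "?P' A" if "dips ?S A (- e)"
      using that close[OF False] unfolding dips_def by (smt (verit) greaterThanLessThan_iff)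
    ultimately show ?thesis by blast
  qed auto
  have bound: "sign_prob ?S' Q \<le> sign_prob ?S' R + (sign_prob ?S' ?W + sign_prob ?S' ?F)"
    if "\<And>A. Q A \<Longrightarrow> R A \<or> (?W A \<or> ?F A)" for Q R
  proof -
    have "sign_prob ?S' Q \<le> sign_prob ?S' (\<lambda>A. R A \<or> (?W A \<or> ?F A))"
      using that finite_sign_indices by (intro sign_prob_mono) auto
    also have "\<dots> \<le> sign_prob ?S' R + sign_prob ?S' (\<lambda>A. ?W A \<or> ?F A)"
      by (rule sign_prob_disj[OF finite_sign_indices])
    also have "sign_prob ?S' (\<lambda>A. ?W A \<or> ?F A) \<le> sign_prob ?S' ?W + sign_prob ?S' ?F"
      by (rule sign_prob_disj[OF finite_sign_indices])
    finally show ?thesis by simp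
  qed
  have "dip_prob J = sign_prob ?S' ?P"
    unfolding dip_prob_def using sign_prob_restrict[OF finite_sign_indices sub, of ?P] by (simp add: dips_Int)
  then show ?thesis
    using bound[of ?P' ?P, OF up] bound[of ?P ?P', OF down] W F unfolding dip_prob_def by linarith
qed

lemma convergent_dip_prob: "convergent dip_prob"
proof -
  have "Cauchy dip_prob"
  proof (rule metric_CauchyI)
    fix r :: real assume "r > 0"
    obtain K where K: "1 / 2 ^ K < r / 4"
      using real_arch_pow_inv[of "r / 4" "1 / 2"] \<open>r > 0\<close> by (auto simp: power_one_over)
    \<comment> \<open>The largest width for which the lacunary gap separates the two thresholds \<open>\<plusminus>e\<close>.\<close>
    define e :: real where "e = 1 / (6 * 4 ^ K)"
    have e: "e > 0" "6 * 4 ^ K * e \<le> 1" by (auto simp: e_def)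
    have tail: "(\<lambda>J. 2 / (real (J - 1) - 1/4)) \<longlonglongrightarrow> 0"
    proof (subst filterlim_sequentially_Suc[symmetric])
      have "filterlim (\<lambda>J. - 1/4 + real J) at_top sequentially"
        by (intro filterlim_tendsto_add_at_top[OF tendsto_const] filterlim_real_sequentially)
      then have "(\<lambda>J. 2 / (- 1/4 + real J)) \<longlonglongrightarrow> 0"
        by (intro tendsto_divide_0[OF tendsto_const] filterlim_at_top_imp_at_infinity)
      moreover have "real (Suc J - 1) - 1/4 = - 1/4 + real J" for J by simp
      ultimately show "(\<lambda>J. 2 / (real (Suc J - 1) - 1/4)) \<longlonglongrightarrow> 0"
        by (simp only:)
    qed
    have "\<forall>\<^sub>F J in sequentially. 2 / (real (J - 1) - 1/4) < min e (r / 4 * (e / 2)\<^sup>2)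
        \<and> 2 \<le> J \<and> 4 ^ K < J"
      using e \<open>r > 0\<close> by (intro eventually_conj order_tendstoD(2)[OF tail]
        eventually_ge_at_top eventually_gt_at_top) auto
    then obtain N where N: "\<And>J. J \<ge> N \<Longrightarrow> 2 / (real (J - 1) - 1/4) < min e (r / 4 * (e / 2)\<^sup>2)
        \<and> 2 \<le> J \<and> 4 ^ K < J"
      by (auto simp: eventually_sequentially)
    have near: "dist (dip_prob m) (dip_prob N) < r / 2" if "m \<ge> N" for m
    proof -
      have "\<bar>dip_prob m - dip_prob N\<bar> \<le> 1 / 2 ^ K + 2 / (real (N - 1) - 1/4) / (e / 2)\<^sup>2"
        using N[of N] that e by (intro dip_prob_diff_le) auto
      moreover have "2 / (real (N - 1) - 1/4) / (e / 2)\<^sup>2 < r / 4"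
        using N[of N] e by (subst pos_divide_less_eq) auto
      ultimately show ?thesis using K by (simp add: dist_real_def)
    qed
    have "dist (dip_prob m) (dip_prob n) < r" if "m \<ge> N" "n \<ge> N" for m n
      using near[OF that(1)] near[OF that(2)] by (rule dist_triangle_half_l)
    then show "\<exists>M. \<forall>m\<ge>M. \<forall>n\<ge>M. dist (dip_prob m) (dip_prob n) < r" by blast
  qed
  then show ?thesis by (rule Cauchy_convergent)
qed

section \<open>From rational functions to sign patterns\<close>

text \<open>Near \<open>0\<close> the pole \<open>1/x\<close> dominates, since each of the other terms is at most \<open>1\<close> in absolute value;
so a value \<open>\<le> 0\<close> yields a zero by the intermediate value theorem.\<close>

lemma zero_iff_dips:
  assumes "finite S" "\<And>j. j \<in> S \<Longrightarrow> 1 \<le> depth j"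
  shows "(\<exists>x\<in>{0<..<1}. 1 / x + 1 / (1 - x) + signed_sum S A x = 0) \<longleftrightarrow> dips S A 0"
    (is "(\<exists>x\<in>_. ?g x = 0) \<longleftrightarrow> _")
proof
  assume "dips S A 0"
  then obtain b where b: "0 < b" "b < 1" "?g b \<le> 0" by (auto simp: dips_def)
  define a where "a = min b (1 / real (Suc (card S)))"
  have a: "0 < a" "a \<le> b" using b by (auto simp: a_def)
  have "\<bar>signed_sum S A a\<bar> \<le> (\<Sum>j\<in>S. \<bar>sign A j / (a + of_int j)\<bar>)"
    unfolding signed_sum_def by (rule sum_abs)
  also have "\<dots> \<le> (\<Sum>j\<in>S. 1)"
  proof (intro sum_mono)
    fix j assume "j \<in> S"
    then have "1 \<le> \<bar>a + of_int j\<bar>"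
      using depth_le_abs[of a j] assms(2)[of j] a b by linarith
    then show "\<bar>sign A j / (a + of_int j)\<bar> \<le> 1" by (simp add: abs_divide)
  qed
  finally have "\<bar>signed_sum S A a\<bar> \<le> card S" by simp
  moreover have "real (Suc (card S)) \<le> 1 / a"
    using a by (simp add: a_def min_def field_simps split: if_splits)
  moreover have "1 / (1 - a) \<ge> 0" using a b by simp
  ultimately have ga: "0 \<le> ?g a" unfolding of_nat_Suc by linarith
  have "x + of_int j \<noteq> 0" if "j \<in> S" "a \<le> x" "x \<le> b" for x j
    using depth_le_abs[of x j] assms(2)[OF that(1)] that a b by force
  then have "continuous_on {a..b} ?g"
    unfolding signed_sum_def using a b by (intro continuous_intros) auto
  then obtain x where "a \<le> x" "x \<le> b" "?g x = 0"
    using IVT2'[of ?g b 0 a] ga b(3) a(2) by blast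
  then show "\<exists>x\<in>{0<..<1}. ?g x = 0" using a b by (intro bexI[of _ x]) auto
next
  assume "\<exists>x\<in>{0<..<1}. ?g x = 0"
  then show "dips S A 0" unfolding dips_def by (metis order_refl)
qed

lemma sign_ratfun_eq: "sign_ratfun J (sign A) x = 1 / x + 1 / (1 - x) + signed_sum (sign_indices J) A x"
  by (simp add: sign_ratfun_def signed_sum_def)

lemma signed_sum_residue:
  assumes "finite S" "i \<in> S"
  shows "((\<lambda>x. (x + of_int i) * signed_sum S A x) \<longlongrightarrow> sign A i) (at (- of_int i))"
proof -
  let ?p = "- of_int i :: real"
  have "((\<lambda>x. sign A i + (x + of_int i) * (\<Sum>j\<in>S - {i}. sign A j / (x + of_int j)))
      \<longlongrightarrow> sign A i + (?p + of_int i) * (\<Sum>j\<in>S - {i}. sign A j / (?p + of_int j))) (at ?p)"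
    by (intro tendsto_intros) auto
  then have "((\<lambda>x. sign A i + (x + of_int i) * (\<Sum>j\<in>S - {i}. sign A j / (x + of_int j)))
      \<longlongrightarrow> sign A i) (at ?p)" by simp
  moreover have "\<forall>\<^sub>F x in at ?p. (x + of_int i) * signed_sum S A x
      = sign A i + (x + of_int i) * (\<Sum>j\<in>S - {i}. sign A j / (x + of_int j))"
    unfolding eventually_at_filter
  proof (intro always_eventually allI impI)
    fix x :: real assume "x \<noteq> ?p"
    then have "x + of_int i \<noteq> 0" by (simp add: add_eq_0_iff2)
    then show "(x + of_int i) * signed_sum S A x
      = sign A i + (x + of_int i) * (\<Sum>j\<in>S - {i}. sign A j / (x + of_int j))"
      using assms by (simp add: signed_sum_def sum.remove[of S i] distrib_left)
  qed
  ultimately show ?thesis by (simp add: tendsto_cong)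
qed

text \<open>Different sign patterns have different residues, so counting functions is the same as counting
patterns.\<close>

lemma inj_on_sign_ratfun: "inj_on (\<lambda>A. sign_ratfun J (sign A)) (Pow (sign_indices J))"
proof (rule inj_onI)
  fix A B assume AB: "A \<in> Pow (sign_indices J)" "B \<in> Pow (sign_indices J)"
    and eq: "sign_ratfun J (sign A) = sign_ratfun J (sign B)"
  have sums: "signed_sum (sign_indices J) A = signed_sum (sign_indices J) B"
  proof
    show "signed_sum (sign_indices J) A x = signed_sum (sign_indices J) B x" for x
      using fun_cong[OF eq, of x] by (simp add: sign_ratfun_eq)
  qed
  have "sign A i = sign B i" if "i \<in> sign_indices J" for i
    using signed_sum_residue[OF finite_sign_indices that, of A]
      signed_sum_residue[OF finite_sign_indices that, of B]
    unfolding sums by (rule tendsto_unique[OF at_neq_bot])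
  then show "A = B" using AB by (force simp: sign_def split: if_splits)
qed

lemma sign_ratfuns_eq: "sign_ratfuns J = (\<lambda>A. sign_ratfun J (sign A)) ` Pow (sign_indices J)"
proof
  show "sign_ratfuns J \<subseteq> (\<lambda>A. sign_ratfun J (sign A)) ` Pow (sign_indices J)"
  proof
    fix g assume "g \<in> sign_ratfuns J"
    then obtain \<delta> where d: "\<forall>j\<in>sign_indices J. \<delta> j = 1 \<or> \<delta> j = -1"
      and g: "g = sign_ratfun J \<delta>"
      by (auto simp: sign_ratfuns_def)
    have "g = sign_ratfun J (sign {j \<in> sign_indices J. \<delta> j = 1})"
      unfolding g sign_ratfun_def using d
      by (intro ext arg_cong2[where f = "(+)"] refl sum.cong) (auto simp: sign_def)
    then show "g \<in> (\<lambda>A. sign_ratfun J (sign A)) ` Pow (sign_indices J)" by blast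
  qed
next
  have "sign A j = 1 \<or> sign A j = -1" for A j by (simp add: sign_def)
  then show "(\<lambda>A. sign_ratfun J (sign A)) ` Pow (sign_indices J) \<subseteq> sign_ratfuns J"
    unfolding sign_ratfuns_def by blast
qed

lemma card_zeros_eq:
  "real (card {g \<in> sign_ratfuns J. \<exists>x\<in>{0<..<1}. g x = 0}) = dip_prob J * real (card (sign_ratfuns J))"
proof -
  let ?f = "\<lambda>A. sign_ratfun J (sign A)" and ?S = "sign_indices J"
  have zero: "(\<exists>x\<in>{0<..<1}. ?f A x = 0) \<longleftrightarrow> dips ?S A 0" for A
    unfolding sign_ratfun_eq using finite_sign_indices depth_sign_indices by (rule zero_iff_dips)
  have "{g \<in> sign_ratfuns J. \<exists>x\<in>{0<..<1}. g x = 0} = ?f ` {A \<in> Pow ?S. dips ?S A 0}"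
    unfolding sign_ratfuns_eq using zero by auto
  then have "card {g \<in> sign_ratfuns J. \<exists>x\<in>{0<..<1}. g x = 0} = card (?f ` {A \<in> Pow ?S. dips ?S A 0})"
    by (rule arg_cong)
  also have "\<dots> = card {A \<in> Pow ?S. dips ?S A 0}"
    by (intro card_image inj_on_subset[OF inj_on_sign_ratfun]) auto
  finally have "card {g \<in> sign_ratfuns J. \<exists>x\<in>{0<..<1}. g x = 0} = card {A \<in> Pow ?S. dips ?S A 0}" .
  moreover have "card (sign_ratfuns J) = 2 ^ card ?S"
    unfolding sign_ratfuns_eq
    by (simp add: card_image[OF inj_on_sign_ratfun] card_Pow finite_sign_indices)
  ultimately show ?thesis by (simp add: dip_prob_def sign_prob_def)
qed

section \<open>The limiting proportion\<close>

theorem theorem2: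
  "\<exists>\<kappa>\<^sub>1::real. 1 / 2 > \<kappa>\<^sub>1 \<and> \<kappa>\<^sub>1 > 0 \<and>
     (\<lambda>J. real (card {g \<in> sign_ratfuns J. \<exists>x\<in>{0<..<1}. g x = 0}))
       \<sim>[at_top] (\<lambda>J. \<kappa>\<^sub>1 * real (card (sign_ratfuns J)))"
proof -
  obtain \<kappa> where lim: "dip_prob \<longlonglongrightarrow> \<kappa>" using convergent_dip_prob by (auto simp: convergent_def)
  have "\<kappa> \<le> 3 / 11"
    using dips_upper_bound by (intro LIMSEQ_le_const2[OF lim]) (auto simp: dip_prob_def)
  moreover have "1 / 2 ^ card (sign_indices 16) / 2 \<le> \<kappa>"
    using dips_lower_bound by (intro LIMSEQ_le_const[OF lim]) (auto simp: dip_prob_def)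
  then have "\<kappa> > 0" by (rule less_le_trans[rotated]) simp
  moreover have "dip_prob \<sim>[at_top] (\<lambda>_. \<kappa>)"
    using lim \<open>\<kappa> > 0\<close> by (intro tendsto_imp_asymp_equiv_const) auto
  then have "(\<lambda>J. real (card {g \<in> sign_ratfuns J. \<exists>x\<in>{0<..<1}. g x = 0}))
       \<sim>[at_top] (\<lambda>J. \<kappa> * real (card (sign_ratfuns J)))"
    unfolding card_zeros_eq by (intro asymp_equiv_mult asymp_equiv_refl)
  ultimately show ?thesis by (intro exI[of _ \<kappa>]) auto
qed

end
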